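(* Let $\star\in\{*,T\}$ and $\epsilon_1,\epsilon_2\in\{-1,1\}$. Let $(X_c,\Lambda_c)$ and $(X_f,\Lambda_f)$ be complementary deflating pairs of the regular pencil $L(\lambda)=\lambda M+K\in\mathbb{L}_n(\star,\epsilon_1,\epsilon_2)$, where $\Lambda_c\in\mathbb{C}^{p\times p}$. Suppose that (a) $\sigma(\Lambda_c)\cap\sigma(\epsilon_1\epsilon_2\Lambda_f^\star)=\emptyset$, and (b) $G:=X_c^\star MX_c$ is nonsingular. Let $\Lambda_a,\hat M,\hat K\in\mathbb{C}^{p\times p}$ be such that $$\hat M\Lambda_a+\hat K=G(\Lambda_c-\Lambda_a).$$ Set $$\Delta M:=U\hat MU^\star,\qquad \Delta K:=U\hat KU^\star,\qquad\text{where } U:=MX_cG^{-1}.$$ Then $(X_c,\Lambda_a)$ and $(X_f,\Lambda_f)$ are complementary deflating pairs of the pencil $L_\Delta(\lambda)=\lambda(M+\Delta M)+(K+\Delta K)$. Furthermore, $L_\Delta(\lambda)\in\mathbb{L}_n(\star,\epsilon_1,\epsilon_2)$ whenever $\lambda\hat M+\hat K\in\mathbb{L}_p(\star,\epsilon_1,\epsilon_2)$. The latter holds if and only if $\lambda\hat M+(\hat M+G)\Lambda_a\in\mathbb{L}_p(\star,\epsilon_1,\epsilon_2)$.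
   Context: $A^T$ is the transpose and $A^*$ the conjugate transpose of $A$. For $\star\in\{*,T\}$ and $\epsilon_1,\epsilon_2\in\{-1,1\}$, $\mathbb{L}_n(\star,\epsilon_1,\epsilon_2)$ is the set of pencils $\lambda M+K\in\mathbb{C}^{n\times n}[\lambda]$ with $M^\star=\epsilon_1M$ and $K^\star=\epsilon_2K$. A pencil $\lambda M+K$ is regular if $\det(\lambda M+K)$ is not the zero polynomial. A deflating pair of a pencil $\lambda M+K\in\mathbb{C}^{n\times n}[\lambda]$ is a matrix pair $(X,\Lambda)\in\mathbb{C}^{n\times p}\times\mathbb{C}^{p\times p}$ with $\operatorname{rank}X=p\le n$ and $MX\Lambda+KX=0$ ($\Lambda$ need not be diagonal). Two deflating pairs $(X_1,\Lambda_1)$, $(X_2,\Lambda_2)$ are complementary if $[X_1\ X_2]$ is a nonsingular square matrix. $\sigma(\Lambda)$ denotes the spectrum of $\Lambda$. *)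

theory Defs
  imports
    "Jordan_Normal_Form.Gauss_Jordan_Elimination"
    "Jordan_Normal_Form.Schur_Decomposition"
    "Jordan_Normal_Form.Spectral_Radius"
    "Jordan_Normal_Form.DL_Rank"
begin

definition pencil :: "complex mat \<Rightarrow> complex mat \<Rightarrow> complex poly mat" where
  "pencil M K = [:0, 1:] \<cdot>\<^sub>m map_mat (\<lambda>a. [:a:]) M + map_mat (\<lambda>a. [:a:]) K"

(* The parameter star is instantiated with mat_adjoint or transpose_mat. *)
definition structured_pencils ::
    "nat \<Rightarrow> (complex mat \<Rightarrow> complex mat) \<Rightarrow> complex \<Rightarrow> complex \<Rightarrow> complex poly mat set" where
  "structured_pencils n star \<epsilon>1 \<epsilon>2 =
    {pencil M K | M K. M \<in> carrier_mat n n \<and> K \<in> carrier_mat n n \<and>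
                       star M = \<epsilon>1 \<cdot>\<^sub>m M \<and> star K = \<epsilon>2 \<cdot>\<^sub>m K}"

definition regular_pencil :: "complex poly mat \<Rightarrow> bool" where
  "regular_pencil L \<longleftrightarrow> det L \<noteq> 0"

definition deflating_pair ::
    "nat \<Rightarrow> nat \<Rightarrow> complex mat \<Rightarrow> complex mat \<Rightarrow> complex mat \<Rightarrow> complex mat \<Rightarrow> bool" where
  "deflating_pair n p M K X \<Lambda> \<longleftrightarrow>
    X \<in> carrier_mat n p \<and> \<Lambda> \<in> carrier_mat p p \<and> vec_space.rank n X = p \<and> p \<le> n \<and>
    M * X * \<Lambda> + K * X = 0\<^sub>m n p"

(* mat_of_cols n (cols X1 @ cols X2) is the block row [X1 X2]; invertible_mat includes that the
   matrix is square. *)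
definition complementary :: "nat \<Rightarrow> complex mat \<Rightarrow> complex mat \<Rightarrow> bool" where
  "complementary n X1 X2 \<longleftrightarrow> invertible_mat (mat_of_cols n (cols X1 @ cols X2))"

definition complementary_deflating_pairs ::
    "nat \<Rightarrow> nat \<Rightarrow> nat \<Rightarrow> complex mat \<Rightarrow> complex mat \<Rightarrow> complex mat \<Rightarrow> complex mat \<Rightarrow>
     complex mat \<Rightarrow> complex mat \<Rightarrow> bool" where
  "complementary_deflating_pairs n p q M K X1 \<Lambda>1 X2 \<Lambda>2 \<longleftrightarrow>
    deflating_pair n p M K X1 \<Lambda>1 \<and> deflating_pair n q M K X2 \<Lambda>2 \<and> complementary n X1 X2"

(* This is the inverse only for invertible A; for other A the value is unspecified. *)
definition mat_inv :: "complex mat \<Rightarrow> complex mat" where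
  "mat_inv A = the (mat_inverse A)"

lemma pencil_eq_iff:
  assumes "M \<in> carrier_mat n n" "K \<in> carrier_mat n n" "M' \<in> carrier_mat n n" "K' \<in> carrier_mat n n"
  shows "pencil M K = pencil M' K' \<longleftrightarrow> M = M' \<and> K = K'"
proof
  assume eq: "pencil M K = pencil M' K'"
  have ent: "M $$ (i,j) = M' $$ (i,j) \<and> K $$ (i,j) = K' $$ (i,j)" if "i < n" "j < n" for i j
  proof -
    have "pencil M K $$ (i,j) = pencil M' K' $$ (i,j)" using eq by simp
    then show ?thesis using assms that by (auto simp: pencil_def)
  qed
  show "M = M' \<and> K = K'"
    using assms ent by (auto intro!: eq_matI)
qed simp

lemma pencil_in_structured_pencils_iff:
  assumes "M \<in> carrier_mat n n" "K \<in> carrier_mat n n"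
  shows "pencil M K \<in> structured_pencils n star \<epsilon>1 \<epsilon>2 \<longleftrightarrow>
    star M = \<epsilon>1 \<cdot>\<^sub>m M \<and> star K = \<epsilon>2 \<cdot>\<^sub>m K"
  using assms pencil_eq_iff[OF assms] by (auto simp: structured_pencils_def)

lemma mat_inv:
  assumes A: "A \<in> carrier_mat n n" and inv: "invertible_mat A"
  shows "mat_inv A \<in> carrier_mat n n" "A * mat_inv A = 1\<^sub>m n" "mat_inv A * A = 1\<^sub>m n"
proof -
  obtain B where B: "A * B = 1\<^sub>m n" "B * A = 1\<^sub>m (dim_row B)"
    using inv A by (auto simp: invertible_mat_def inverts_mat_def)
  have "dim_col (A * B) = n" "dim_col (B * A) = dim_row B" by (simp_all only: B index_one_mat)
  then have Bc: "B \<in> carrier_mat n n" using A by auto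
  have "A \<in> Units (ring_mat TYPE(complex) n ())"
    using A B Bc by (auto simp: Units_def ring_mat_def)
  then obtain C where C: "mat_inverse A = Some C" using mat_inverse(1)[OF A, of "()"] by (cases "mat_inverse A") auto
  show "mat_inv A \<in> carrier_mat n n" "A * mat_inv A = 1\<^sub>m n" "mat_inv A * A = 1\<^sub>m n"
    using mat_inverse(2)[OF A C] C by (auto simp: mat_inv_def)
qed

end

theory Submission
  imports Defs
begin

text \<open>
  Multiplying the equation of the first deflating pair by \<open>Xf\<^sup>\<star>\<close> from the left, and applying
  \<open>\<star>\<close> to the equation of the second one, expresses \<open>Xf\<^sup>\<star> K Xc\<close> in two ways and so gives the
  Sylvester equation \<open>Y \<Lambda>c = \<epsilon>1 \<epsilon>2 \<Lambda>f\<^sup>\<star> Y\<close> for \<open>Y = Xf\<^sup>\<star> M Xc\<close>. The two coefficients have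
  disjoint spectra, hence \<open>Y = 0\<close>
  (\<open>sylvester_disjoint_spectra_zero\<close>, \<open>deflating_blocks_orthogonal\<close>).

  As \<open>G\<^sup>\<star> = \<epsilon>1 G\<close>, the signs cancel in \<open>U\<^sup>\<star> = G\<^sup>-\<^sup>1 Xc\<^sup>\<star> M\<close> (\<open>star_update_factor\<close>). Therefore
  \<open>U\<^sup>\<star> Xc = I\<close>, while \<open>U\<^sup>\<star> Xf = G\<^sup>-\<^sup>1 Xc\<^sup>\<star> M Xf = 0\<close> because \<open>Xc\<^sup>\<star> M Xf\<close> is \<open>Y\<^sup>\<star>\<close> up to sign.
  Thus the update is invisible on \<open>Xf\<close>, whereas on \<open>Xc\<close> it adds
  \<open>U (Mh \<Lambda>a + Kh) = U G (\<Lambda>c - \<Lambda>a) = M Xc (\<Lambda>c - \<Lambda>a)\<close> to the residual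
  \<open>M Xc \<Lambda>a + K Xc\<close>, which turns it into \<open>M Xc \<Lambda>c + K Xc = 0\<close>.

  A congruence \<open>U A U\<^sup>\<star>\<close> inherits the symmetry of \<open>A\<close>, so the update is structured if \<open>Mh\<close> and
  \<open>Kh\<close> are. Finally \<open>(Mh + G) \<Lambda>a = G \<Lambda>c - Kh\<close>, and \<open>G \<Lambda>c = - Xc\<^sup>\<star> K Xc\<close> has the symmetry of
  \<open>K\<close>; so \<open>(Mh + G) \<Lambda>a\<close> has the symmetry of \<open>K\<close> exactly when \<open>Kh\<close> has it.
\<close>

section \<open>Transpose and adjoint\<close>

text \<open>Both instances of \<open>\<star>\<close> are the transpose followed by an entrywise involutive ring
  automorphism, which is all that the algebraic rules below depend on.\<close>

lemma star_entrywise: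
  assumes "star \<in> {mat_adjoint, transpose_mat :: complex mat \<Rightarrow> complex mat}"
  obtains f :: "complex \<Rightarrow> complex" where
    "\<And>A. star A = mat (dim_col A) (dim_row A) (\<lambda>(i,j). f (A $$ (j,i)))"
    "\<And>a b. f (a + b) = f a + f b" "\<And>a b. f (a * b) = f a * f b"
    "f 0 = 0" "f 1 = 1" "\<And>a. f (- a) = - f a" "\<And>a. f (f a) = a"
proof (cases "star = mat_adjoint")
  case True
  have "mat_adjoint A = mat (dim_col A) (dim_row A) (\<lambda>(i,j). cnj (A $$ (j,i)))" for A :: "complex mat"
    by (auto simp: mat_adjoint_def mat_of_rows_def)
  with True show ?thesis by (intro that[of cnj]) auto
next
  case False
  with assms have "star = transpose_mat" by auto
  then show ?thesis by (intro that[of "\<lambda>a. a"]) (auto simp: transpose_mat_def)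
qed

lemma star_carrier:
  assumes "star \<in> {mat_adjoint, transpose_mat :: complex mat \<Rightarrow> complex mat}" "A \<in> carrier_mat m n"
  shows "star A \<in> carrier_mat n m"
  using assms(2) by (rule_tac star_entrywise[OF assms(1)]) auto

lemma star_star:
  assumes "star \<in> {mat_adjoint, transpose_mat :: complex mat \<Rightarrow> complex mat}"
  shows "star (star A) = A"
  by (rule star_entrywise[OF assms]) auto

lemma star_mult:
  assumes star: "star \<in> {mat_adjoint, transpose_mat :: complex mat \<Rightarrow> complex mat}"
    and A: "A \<in> carrier_mat m n" and B: "B \<in> carrier_mat n k"
  shows "star (A * B) = star B * star A"
proof -
  obtain f where f: "\<And>A. star A = mat (dim_col A) (dim_row A) (\<lambda>(i,j). f (A $$ (j,i)))"
    and add: "\<And>a b. f (a + b) = f a + f b" and mult: "\<And>a b. f (a * b) = f a * f b"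
    and zero: "f 0 = 0"
    by (rule star_entrywise[OF star]) blast
  have fsum: "f (sum g S) = (\<Sum>x\<in>S. f (g x))" for g :: "nat \<Rightarrow> complex" and S
    by (induction S rule: infinite_finite_induct) (auto simp: add zero)
  show ?thesis
    using A B by (auto simp: f scalar_prod_def fsum mult mult.commute intro!: sum.cong)
qed

lemma star_add:
  assumes "star \<in> {mat_adjoint, transpose_mat :: complex mat \<Rightarrow> complex mat}"
    and "A \<in> carrier_mat m n" "B \<in> carrier_mat m n"
  shows "star (A + B) = star A + star B"
  using assms(2,3) by (rule_tac star_entrywise[OF assms(1)]) auto

lemma star_minus:
  assumes "star \<in> {mat_adjoint, transpose_mat :: complex mat \<Rightarrow> complex mat}"
    and "A \<in> carrier_mat m n" "B \<in> carrier_mat m n"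
  shows "star (A - B) = star A - star B"
proof (rule star_entrywise[OF assms(1)])
  fix f :: "complex \<Rightarrow> complex"
  assume f: "\<And>A. star A = mat (dim_col A) (dim_row A) (\<lambda>(i,j). f (A $$ (j,i)))"
    and h: "\<And>a b. f (a + b) = f a + f b" "\<And>a. f (- a) = - f a"
  have "f (a - b) = f a - f b" for a b using h(1)[of a "- b"] h(2)[of b] by simp
  with assms(2,3) f show ?thesis by auto
qed

lemma star_smult_sign:
  assumes "star \<in> {mat_adjoint, transpose_mat :: complex mat \<Rightarrow> complex mat}"
    and "\<epsilon> \<in> {-1, 1}"
  shows "star (\<epsilon> \<cdot>\<^sub>m A) = \<epsilon> \<cdot>\<^sub>m star A"
  using assms(2) by (rule_tac star_entrywise[OF assms(1)]) auto

lemma star_zero: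
  assumes "star \<in> {mat_adjoint, transpose_mat :: complex mat \<Rightarrow> complex mat}"
  shows "star (0\<^sub>m m n) = 0\<^sub>m n m"
  by (rule star_entrywise[OF assms]) auto

lemma star_one:
  assumes "star \<in> {mat_adjoint, transpose_mat :: complex mat \<Rightarrow> complex mat}"
  shows "star (1\<^sub>m n) = 1\<^sub>m n"
  by (rule star_entrywise[OF assms]) auto

lemma sign_smult_sign_smult:
  fixes \<epsilon> :: complex
  assumes "\<epsilon> \<in> {-1, 1}"
  shows "\<epsilon> \<cdot>\<^sub>m (\<epsilon> \<cdot>\<^sub>m A) = A"
  using assms by auto

lemma star_congruence:
  assumes star: "star \<in> {mat_adjoint, transpose_mat :: complex mat \<Rightarrow> complex mat}"
    and A: "A \<in> carrier_mat n n" "star A = \<epsilon> \<cdot>\<^sub>m A" and B: "B \<in> carrier_mat m n"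
  shows "star (B * A * star B) = \<epsilon> \<cdot>\<^sub>m (B * A * star B)"
proof -
  note sB = star_carrier[OF star B]
  have "star (B * A * star B) = star (star B) * star (B * A)"
    using A B sB by (intro star_mult[OF star]) auto
  also have "\<dots> = B * (\<epsilon> \<cdot>\<^sub>m A * star B)"
    by (simp add: star_star[OF star] star_mult[OF star B A(1)] A(2))
  also have "\<dots> = \<epsilon> \<cdot>\<^sub>m (B * A * star B)"
    using A(1) B sB
    by (simp add: mult_smult_assoc_mat[of _ n n _ m] mult_smult_distrib[of _ m n _ m]
        assoc_mult_mat[of _ m n _ n _ m])
  finally show ?thesis .
qed

section \<open>Sylvester equations with disjoint spectra\<close>

text \<open>Column by column: once the columns of \<open>Z\<close> before the \<open>j\<close>-th vanish, the equation says that
  the \<open>j\<close>-th column, if nonzero, is an eigenvector of \<open>B\<close> for the \<open>j\<close>-th diagonal entry of \<open>T\<close>.\<close>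

lemma sylvester_upper_triangular_zero:
  fixes B T Z :: "'a :: field mat"
  assumes T: "T \<in> carrier_mat p p" and ut: "upper_triangular T"
    and B: "B \<in> carrier_mat q q" and Z: "Z \<in> carrier_mat q p"
    and eq: "Z * T = B * Z"
    and no_ev: "\<And>j. j < p \<Longrightarrow> \<not> eigenvalue B (T $$ (j,j))"
  shows "Z = 0\<^sub>m q p"
proof -
  have "j < p \<Longrightarrow> col Z j = 0\<^sub>v q" for j
  proof (induction j rule: less_induct)
    case (less j)
    have "B *\<^sub>v col Z j = col (Z * T) j"
      unfolding eq using col_mult2[OF B Z less.prems] by simp
    also have "\<dots> = T $$ (j,j) \<cdot>\<^sub>v col Z j"
    proof (rule eq_vecI)
      fix i assume "i < dim_vec (T $$ (j,j) \<cdot>\<^sub>v col Z j)"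
      then have i: "i < q" using Z by simp
      have vanish: "Z $$ (i,k) * T $$ (k,j) = 0" if "k < p" "k \<noteq> j" for k
      proof (cases "k < j")
        case True
        then have "col Z k $ i = 0" using less i that by simp
        then show ?thesis using Z i that by simp
      next
        case False
        then show ?thesis using ut T that by (simp add: upper_triangular_def)
      qed
      have "col (Z * T) j $ i = (\<Sum>k<p. Z $$ (i,k) * T $$ (k,j))"
        using Z T i less.prems by (simp add: scalar_prod_def atLeast0LessThan)
      also have "\<dots> = (\<Sum>k\<in>{j}. Z $$ (i,k) * T $$ (k,j))"
        using vanish less.prems by (intro sum.mono_neutral_right) auto
      finally show "col (Z * T) j $ i = (T $$ (j,j) \<cdot>\<^sub>v col Z j) $ i"
        using Z i less.prems by simp
    qed (use Z in simp)
    finally have "B *\<^sub>v col Z j = T $$ (j,j) \<cdot>\<^sub>v col Z j" .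
    moreover have "col Z j \<in> carrier_vec q" using Z by auto
    ultimately show ?case using no_ev[OF less.prems] B
      by (auto simp: eigenvalue_def eigenvector_def)
  qed
  then show ?thesis
    using Z by (intro mat_col_eqI) auto
qed

text \<open>A Schur decomposition \<open>A = P T Q\<close> with \<open>Q = P\<^sup>-\<^sup>1\<close> turns \<open>Y A = B Y\<close> into the triangular
  equation for \<open>Z = Y P\<close>, and the diagonal entries of \<open>T\<close> are eigenvalues of \<open>A\<close>.\<close>

lemma sylvester_disjoint_spectra_zero:
  fixes A B Y :: "complex mat"
  assumes A: "A \<in> carrier_mat p p" and B: "B \<in> carrier_mat q q" and Y: "Y \<in> carrier_mat q p"
    and eq: "Y * A = B * Y" and disj: "spectrum A \<inter> spectrum B = {}"
  shows "Y = 0\<^sub>m q p"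
proof -
  obtain es where es: "char_poly A = (\<Prod>a\<leftarrow>es. [:- a, 1:])"
    using char_poly_factorized[OF A] by auto
  obtain T P Q where schur: "schur_decomposition A es = (T, P, Q)"
    by (cases "schur_decomposition A es") auto
  from schur_decomposition[OF A es schur]
  have sim: "similar_mat_wit A T P Q" and ut: "upper_triangular T" by auto
  from similar_mat_witD2[OF A sim]
  have PQ: "P * Q = 1\<^sub>m p" "Q * P = 1\<^sub>m p" "A = P * T * Q"
    and c: "T \<in> carrier_mat p p" "P \<in> carrier_mat p p" "Q \<in> carrier_mat p p" by auto
  have AP: "A * P = P * T"
  proof -
    have "A * P = P * T * (Q * P)" unfolding PQ(3) using c by (intro assoc_mult_mat) auto
    with PQ c show ?thesis by simp
  qed
  have "(Y * P) * T = Y * A * P" using Y A c by (simp add: AP assoc_mult_mat[of _ q p _ p _ p])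
  also have "\<dots> = B * (Y * P)" unfolding eq using B Y c by (intro assoc_mult_mat) auto
  finally have ZT: "(Y * P) * T = B * (Y * P)" .
  have "\<not> eigenvalue B (T $$ (j,j))" if "j < p" for j
  proof -
    have "T $$ (j,j) \<in> set (diag_mat T)" using that c by (auto simp: diag_mat_def)
    moreover have "char_poly A = (\<Prod>a\<leftarrow>diag_mat T. [:- a, 1:])"
      using char_poly_similar[of A T] char_poly_upper_triangular[OF c(1) ut] sim
      by (auto simp: similar_mat_def)
    ultimately have "eigenvalue A (T $$ (j,j))"
      unfolding eigenvalue_root_char_poly[OF A] by (auto simp: poly_prod_list prod_list_zero_iff)
    with disj show ?thesis by (auto simp: spectrum_def)
  qed
  from sylvester_upper_triangular_zero[OF c(1) ut B _ ZT this]
  have "Y * P = 0\<^sub>m q p" using Y c by auto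
  moreover have "Y = Y * P * Q" using Y c PQ by (simp add: assoc_mult_mat[of _ q p _ p _ p])
  ultimately show ?thesis using c by simp
qed

section \<open>Additive rearrangements\<close>

lemma mat_add_add_swap:
  fixes A B C D :: "'a :: comm_monoid_add mat"
  assumes "A \<in> carrier_mat m n" "B \<in> carrier_mat m n" "C \<in> carrier_mat m n" "D \<in> carrier_mat m n"
  shows "(A + B) + (C + D) = A + (B + D) + C"
  using assms by (auto simp: ac_simps)

lemma mat_add_diff_cancel:
  fixes A B :: "'a :: ab_group_add mat"
  assumes "A \<in> carrier_mat m n" "B \<in> carrier_mat m n"
  shows "A + (B - A) = B" "(B - A) + A = B" "(A + B) - A = B"
  using assms by auto

lemma smult_minus_mat:
  fixes A B :: "'a :: ring mat"
  assumes "A \<in> carrier_mat m n" "B \<in> carrier_mat m n"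
  shows "k \<cdot>\<^sub>m A - k \<cdot>\<^sub>m B = k \<cdot>\<^sub>m (A - B)"
  using assms by (auto simp: right_diff_distrib)

section \<open>The structured update of a deflating pair\<close>

text \<open>With \<open>Y = Xf\<^sup>\<star> M Xc\<close>, the first pair gives \<open>Xf\<^sup>\<star> K Xc = - Y \<Lambda>c\<close>. Applying \<open>\<star>\<close> to the
  equation of the second pair exchanges \<open>M\<^sup>\<star>\<close> and \<open>K\<^sup>\<star>\<close> for signed copies of \<open>M\<close> and \<open>K\<close>, so that
  also \<open>Xf\<^sup>\<star> K Xc = - \<epsilon>1 \<epsilon>2 \<Lambda>f\<^sup>\<star> Y\<close>. The right coefficient of the resulting Sylvester equation is
  \<open>\<Lambda>c\<close> and the left one is \<open>\<epsilon>1 \<epsilon>2 \<Lambda>f\<^sup>\<star>\<close>, whence the spectral condition.\<close>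

lemma deflating_blocks_orthogonal:
  assumes star: "star \<in> {mat_adjoint, transpose_mat :: complex mat \<Rightarrow> complex mat}"
    and eps: "\<epsilon>1 \<in> {-1, 1}" "\<epsilon>2 \<in> {-1, 1}"
    and M: "M \<in> carrier_mat n n" "star M = \<epsilon>1 \<cdot>\<^sub>m M"
    and K: "K \<in> carrier_mat n n" "star K = \<epsilon>2 \<cdot>\<^sub>m K"
    and Xc: "Xc \<in> carrier_mat n p" and Lc: "\<Lambda>c \<in> carrier_mat p p"
    and Xf: "Xf \<in> carrier_mat n q" and Lf: "\<Lambda>f \<in> carrier_mat q q"
    and eqc: "M * Xc * \<Lambda>c + K * Xc = 0\<^sub>m n p"
    and eqf: "M * Xf * \<Lambda>f + K * Xf = 0\<^sub>m n q"
    and disj: "spectrum \<Lambda>c \<inter> spectrum ((\<epsilon>1 * \<epsilon>2) \<cdot>\<^sub>m star \<Lambda>f) = {}"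
  shows "star Xf * M * Xc = 0\<^sub>m q p" "star Xc * M * Xf = 0\<^sub>m p q"
proof -
  note sXf = star_carrier[OF star Xf] and sXc = star_carrier[OF star Xc]
    and sLf = star_carrier[OF star Lf]
  define Y where "Y = star Xf * M * Xc"
  have Y: "Y \<in> carrier_mat q p" using sXf M Xc by (auto simp: Y_def)
  define N where "N = star Xf * K * Xc"
  have N: "N \<in> carrier_mat q p" using sXf K Xc by (auto simp: N_def)
  have e1: "Y * \<Lambda>c + N = 0\<^sub>m q p"
  proof -
    have "star Xf * (M * Xc * \<Lambda>c + K * Xc) = star Xf * (M * Xc * \<Lambda>c) + star Xf * (K * Xc)"
      using sXf M K Xc Lc by (intro mult_add_distrib_mat) auto
    also have "\<dots> = Y * \<Lambda>c + N"
      unfolding Y_def N_def using sXf M(1) K(1) Xc Lc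
      by (simp add: assoc_mult_mat[of _ q n _ n _ p] assoc_mult_mat[of _ q n _ p _ p] assoc_mult_mat[of _ n n _ p _ p])
    finally show ?thesis using sXf by (simp add: eqc)
  qed
  have e2: "\<epsilon>1 \<cdot>\<^sub>m (star \<Lambda>f * Y) + \<epsilon>2 \<cdot>\<^sub>m N = 0\<^sub>m q p"
  proof -
    have MX: "M * Xf \<in> carrier_mat n q" using M Xf by auto
    have "star (M * Xf * \<Lambda>f + K * Xf) = star (M * Xf * \<Lambda>f) + star (K * Xf)"
      using M K Xf Lf by (intro star_add[OF star]) auto
    also have "\<dots> = star \<Lambda>f * (star Xf * (\<epsilon>1 \<cdot>\<^sub>m M)) + star Xf * (\<epsilon>2 \<cdot>\<^sub>m K)"
      by (simp add: star_mult[OF star MX Lf] star_mult[OF star M(1) Xf] star_mult[OF star K(1) Xf] M(2) K(2))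
    also have "\<dots> = \<epsilon>1 \<cdot>\<^sub>m (star \<Lambda>f * (star Xf * M)) + \<epsilon>2 \<cdot>\<^sub>m (star Xf * K)"
      using sXf sLf M(1) K(1) by (simp add: mult_smult_distrib[of _ q n] mult_smult_distrib[of _ q q _ n])
    finally have z: "\<epsilon>1 \<cdot>\<^sub>m (star \<Lambda>f * (star Xf * M)) + \<epsilon>2 \<cdot>\<^sub>m (star Xf * K) = 0\<^sub>m q n"
      by (simp add: eqf star_zero[OF star])
    have "(\<epsilon>1 \<cdot>\<^sub>m (star \<Lambda>f * (star Xf * M)) + \<epsilon>2 \<cdot>\<^sub>m (star Xf * K)) * Xc
        = \<epsilon>1 \<cdot>\<^sub>m (star \<Lambda>f * (star Xf * M)) * Xc + \<epsilon>2 \<cdot>\<^sub>m (star Xf * K) * Xc"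
      using sXf sLf M(1) K(1) Xc by (intro add_mult_distrib_mat) auto
    also have "\<dots> = \<epsilon>1 \<cdot>\<^sub>m (star \<Lambda>f * Y) + \<epsilon>2 \<cdot>\<^sub>m N"
      unfolding Y_def N_def using sXf sLf M(1) K(1) Xc
      by (simp add: mult_smult_assoc_mat[of _ q n] assoc_mult_mat[of _ q q _ n _ p])
    finally show ?thesis using z Xc by simp
  qed
  have "Y * \<Lambda>c = ((\<epsilon>1 * \<epsilon>2) \<cdot>\<^sub>m star \<Lambda>f) * Y"
  proof (rule eq_matI)
    fix i j assume "i < dim_row (((\<epsilon>1 * \<epsilon>2) \<cdot>\<^sub>m star \<Lambda>f) * Y)" "j < dim_col (((\<epsilon>1 * \<epsilon>2) \<cdot>\<^sub>m star \<Lambda>f) * Y)"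
    then have ij: "i < q" "j < p" using sLf Y by auto
    have "(Y * \<Lambda>c + N) $$ (i,j) = 0" using e1 ij by simp
    then have 1: "(Y * \<Lambda>c) $$ (i,j) + N $$ (i,j) = 0" using ij Y Lc N by simp
    have "(\<epsilon>1 \<cdot>\<^sub>m (star \<Lambda>f * Y) + \<epsilon>2 \<cdot>\<^sub>m N) $$ (i,j) = 0" using e2 ij by simp
    then have 2: "\<epsilon>1 * (star \<Lambda>f * Y) $$ (i,j) + \<epsilon>2 * N $$ (i,j) = 0"
      using ij Y sLf N by simp
    have "(Y * \<Lambda>c) $$ (i,j) = (\<epsilon>1 * \<epsilon>2) * (star \<Lambda>f * Y) $$ (i,j)"
      using 1 2 eps by (auto simp: add_eq_0_iff add_eq_0_iff2)
    then show "(Y * \<Lambda>c) $$ (i,j) = (((\<epsilon>1 * \<epsilon>2) \<cdot>\<^sub>m star \<Lambda>f) * Y) $$ (i,j)"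
      using ij Y sLf by (simp add: mult_smult_assoc_mat[of _ q q _ p])
  qed (use Y Lc sLf in auto)
  from sylvester_disjoint_spectra_zero[OF Lc _ Y this disj] sLf
  have Y0: "Y = 0\<^sub>m q p" by auto
  then show "star Xf * M * Xc = 0\<^sub>m q p" by (simp add: Y_def)
  have sM: "star Xf * M \<in> carrier_mat q n" using sXf M by auto
  have "star Y = star Xc * (star M * Xf)"
    unfolding Y_def by (simp add: star_mult[OF star sM Xc] star_mult[OF star sXf M(1)] star_star[OF star])
  also have "\<dots> = \<epsilon>1 \<cdot>\<^sub>m (star Xc * M * Xf)"
    using sXc M(1) Xf
    by (simp add: M(2) mult_smult_assoc_mat[of _ n n _ q] mult_smult_distrib[of _ p n _ q] assoc_mult_mat[of _ p n _ n _ q])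
  finally have "\<epsilon>1 \<cdot>\<^sub>m (star Xc * M * Xf) = 0\<^sub>m p q"
    by (simp add: Y0 star_zero[OF star])
  with sign_smult_sign_smult[OF eps(1), of "star Xc * M * Xf"]
  show "star Xc * M * Xf = 0\<^sub>m p q" by simp
qed

text \<open>The inverse of \<open>G\<close> inherits the sign of \<open>G\<close>, and this sign cancels that of \<open>M\<close>.\<close>

lemma star_update_factor:
  assumes star: "star \<in> {mat_adjoint, transpose_mat :: complex mat \<Rightarrow> complex mat}"
    and eps: "\<epsilon> \<in> {-1, 1}"
    and M: "M \<in> carrier_mat n n" "star M = \<epsilon> \<cdot>\<^sub>m M" and X: "X \<in> carrier_mat n p"
    and G: "G = star X * M * X" and inv: "invertible_mat G"
  shows "star (M * X * mat_inv G) = mat_inv G * (star X * M)"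
proof -
  note sX = star_carrier[OF star X]
  have Gc: "G \<in> carrier_mat p p" using sX M X by (auto simp: G)
  note H = mat_inv[OF Gc inv]
  note sH = star_carrier[OF star H(1)]
  have sG: "star G = \<epsilon> \<cdot>\<^sub>m G"
    using star_congruence[OF star M sX] by (simp add: G star_star[OF star])
  have "star (mat_inv G) * star G = star (G * mat_inv G)"
    using star_mult[OF star Gc H(1)] by simp
  then have "\<epsilon> \<cdot>\<^sub>m (star (mat_inv G) * G) = 1\<^sub>m p"
    using sH Gc by (simp add: H star_one[OF star] sG mult_smult_distrib[of _ p p _ p])
  with sign_smult_sign_smult[OF eps, of "star (mat_inv G) * G"]
  have sHG: "star (mat_inv G) * G = \<epsilon> \<cdot>\<^sub>m 1\<^sub>m p" by simp
  have "star (mat_inv G) = star (mat_inv G) * G * mat_inv G"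
    using sH H Gc by (simp add: assoc_mult_mat[of _ p p _ p _ p])
  then have sHe: "star (mat_inv G) = \<epsilon> \<cdot>\<^sub>m mat_inv G"
    using H(1) by (simp add: sHG mult_smult_assoc_mat[of _ p p _ p])
  have MX: "M * X \<in> carrier_mat n p" using M X by auto
  have "star (M * X * mat_inv G) = (\<epsilon> \<cdot>\<^sub>m mat_inv G) * (star X * (\<epsilon> \<cdot>\<^sub>m M))"
    by (simp add: star_mult[OF star MX H(1)] star_mult[OF star M(1) X] sHe M(2))
  also have "\<dots> = \<epsilon> \<cdot>\<^sub>m (\<epsilon> \<cdot>\<^sub>m (mat_inv G * (star X * M)))"
    using H(1) sX M(1)
    by (simp add: mult_smult_assoc_mat[of _ p p _ n] mult_smult_distrib[of _ p n _ n] mult_smult_distrib[of _ p p _ n])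
  finally show ?thesis by (simp add: sign_smult_sign_smult[OF eps])
qed

theorem theorem5p1:
  fixes star :: "complex mat \<Rightarrow> complex mat" and \<epsilon>1 \<epsilon>2 :: complex
    and n p q :: nat
    and M K Xc Xf \<Lambda>c \<Lambda>f \<Lambda>a Mh Kh G U \<Delta>M \<Delta>K :: "complex mat"
  assumes star: "star \<in> {mat_adjoint, transpose_mat}"
    and eps: "\<epsilon>1 \<in> {-1, 1}" "\<epsilon>2 \<in> {-1, 1}"
    and MK: "M \<in> carrier_mat n n" "K \<in> carrier_mat n n"
    and struct: "pencil M K \<in> structured_pencils n star \<epsilon>1 \<epsilon>2"
    and regular: "regular_pencil (pencil M K)"
    and pairs: "complementary_deflating_pairs n p q M K Xc \<Lambda>c Xf \<Lambda>f"
    and a: "spectrum \<Lambda>c \<inter> spectrum ((\<epsilon>1 * \<epsilon>2) \<cdot>\<^sub>m star \<Lambda>f) = {}"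
    and G: "G = star Xc * M * Xc"
    and b: "invertible_mat G"
    and new: "\<Lambda>a \<in> carrier_mat p p" "Mh \<in> carrier_mat p p" "Kh \<in> carrier_mat p p"
    and eq: "Mh * \<Lambda>a + Kh = G * (\<Lambda>c - \<Lambda>a)"
    and U: "U = M * Xc * mat_inv G"
    and \<Delta>M: "\<Delta>M = U * Mh * star U"
    and \<Delta>K: "\<Delta>K = U * Kh * star U"
  shows "complementary_deflating_pairs n p q (M + \<Delta>M) (K + \<Delta>K) Xc \<Lambda>a Xf \<Lambda>f \<and>
    (pencil Mh Kh \<in> structured_pencils p star \<epsilon>1 \<epsilon>2 \<longrightarrow>
      pencil (M + \<Delta>M) (K + \<Delta>K) \<in> structured_pencils n star \<epsilon>1 \<epsilon>2) \<and>
    (pencil Mh Kh \<in> structured_pencils p star \<epsilon>1 \<epsilon>2 \<longleftrightarrow>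
      pencil Mh ((Mh + G) * \<Lambda>a) \<in> structured_pencils p star \<epsilon>1 \<epsilon>2)"
proof -
  from pairs have Xc: "Xc \<in> carrier_mat n p" and Lc: "\<Lambda>c \<in> carrier_mat p p"
    and Xf: "Xf \<in> carrier_mat n q" and Lf: "\<Lambda>f \<in> carrier_mat q q"
    and eqc: "M * Xc * \<Lambda>c + K * Xc = 0\<^sub>m n p" and eqf: "M * Xf * \<Lambda>f + K * Xf = 0\<^sub>m n q"
    unfolding complementary_deflating_pairs_def deflating_pair_def by blast+
  have sM: "star M = \<epsilon>1 \<cdot>\<^sub>m M" and sK: "star K = \<epsilon>2 \<cdot>\<^sub>m K"
    using struct pencil_in_structured_pencils_iff[OF MK] by auto
  note sXc = star_carrier[OF star Xc]
  have Gc: "G \<in> carrier_mat p p" using sXc MK Xc by (auto simp: G)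
  note H = mat_inv[OF Gc b]
  have Uc: "U \<in> carrier_mat n p" using MK Xc H by (auto simp: U)
  note sU = star_carrier[OF star Uc]
  have DM: "\<Delta>M \<in> carrier_mat n n" and DK: "\<Delta>K \<in> carrier_mat n n"
    using Uc sU new by (auto simp: \<Delta>M \<Delta>K)
  have sU_eq: "star U = mat_inv G * (star Xc * M)"
    unfolding U by (rule star_update_factor[OF star eps(1) MK(1) sM Xc G b])
  have UXc: "star U * Xc = 1\<^sub>m p"
  proof -
    have "star U * Xc = mat_inv G * (star Xc * M * Xc)"
      unfolding sU_eq using H sXc MK Xc by (intro assoc_mult_mat) auto
    then show ?thesis using H by (simp add: G[symmetric])
  qed
  have UXf: "star U * Xf = 0\<^sub>m p q"
  proof -
    have "star U * Xf = mat_inv G * (star Xc * M * Xf)"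
      unfolding sU_eq using H sXc MK Xf by (intro assoc_mult_mat) auto
    then show ?thesis
      using H(1) by (simp add: deflating_blocks_orthogonal(2)[OF star eps MK(1) sM MK(2) sK Xc Lc Xf Lf eqc eqf a])
  qed
  have UG: "U * G = M * Xc"
  proof -
    have "U * G = M * Xc * (mat_inv G * G)"
      unfolding U using MK Xc H Gc by (intro assoc_mult_mat) auto
    then show ?thesis using MK Xc H by simp
  qed
  have DXc: "\<Delta>M * Xc = U * Mh" "\<Delta>K * Xc = U * Kh"
    using Uc sU new Xc by (simp_all add: \<Delta>M \<Delta>K assoc_mult_mat[of _ n p _ n _ p] UXc)
  have DXf: "\<Delta>M * Xf = 0\<^sub>m n q" "\<Delta>K * Xf = 0\<^sub>m n q"
    using Uc sU new Xf by (simp_all add: \<Delta>M \<Delta>K assoc_mult_mat[of _ n p _ n _ q] UXf)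
  have MXc: "M * Xc \<in> carrier_mat n p" and KXc: "K * Xc \<in> carrier_mat n p"
    and MXf: "M * Xf \<in> carrier_mat n q" and KXf: "K * Xf \<in> carrier_mat n q"
    and UMh: "U * Mh \<in> carrier_mat n p" and UKh: "U * Kh \<in> carrier_mat n p"
    using MK Xc Xf Uc new by auto

  have "(M + \<Delta>M) * Xc * \<Lambda>a + (K + \<Delta>K) * Xc = 0\<^sub>m n p"
  proof -
    have "U * Mh * \<Lambda>a + U * Kh = U * (G * (\<Lambda>c - \<Lambda>a))"
      unfolding eq[symmetric] using Uc new
      by (simp add: mult_add_distrib_mat[of _ n p _ p] assoc_mult_mat[of _ n p _ p _ p])
    also have "\<dots> = M * Xc * (\<Lambda>c - \<Lambda>a)"
      unfolding UG[symmetric] using Uc Gc minus_carrier_mat[OF new(1)]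
      by (simp add: assoc_mult_mat[of _ n p _ p _ p])
    also have "\<dots> = M * Xc * \<Lambda>c - M * Xc * \<Lambda>a"
      using MXc Lc new by (intro mult_minus_distrib_mat) auto
    finally have res: "U * Mh * \<Lambda>a + U * Kh = M * Xc * \<Lambda>c - M * Xc * \<Lambda>a" .
    have "(M + \<Delta>M) * Xc * \<Lambda>a + (K + \<Delta>K) * Xc
        = (M * Xc * \<Lambda>a + U * Mh * \<Lambda>a) + (K * Xc + U * Kh)"
      using MK DM DK Xc MXc UMh new
      by (simp add: add_mult_distrib_mat[of _ n n _ _ p] add_mult_distrib_mat[of _ n p _ _ p] DXc)
    also have "\<dots> = M * Xc * \<Lambda>a + (U * Mh * \<Lambda>a + U * Kh) + K * Xc"
      using MXc KXc UMh UKh new by (intro mat_add_add_swap) auto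
    also have "\<dots> = M * Xc * \<Lambda>c + K * Xc"
      unfolding res using MXc Lc new by (subst mat_add_diff_cancel(1)[of _ n p]) auto
    finally show ?thesis by (simp add: eqc)
  qed
  moreover have "(M + \<Delta>M) * Xf * \<Lambda>f + (K + \<Delta>K) * Xf = 0\<^sub>m n q"
    using MK DM DK Xf MXf KXf by (simp add: add_mult_distrib_mat[of _ n n _ _ q] DXf eqf)
  ultimately have part1: "complementary_deflating_pairs n p q (M + \<Delta>M) (K + \<Delta>K) Xc \<Lambda>a Xf \<Lambda>f"
    using pairs new(1) by (auto simp: complementary_deflating_pairs_def deflating_pair_def)

  have struct_hat: "pencil Mh A \<in> structured_pencils p star \<epsilon>1 \<epsilon>2 \<longleftrightarrow>
      star Mh = \<epsilon>1 \<cdot>\<^sub>m Mh \<and> star A = \<epsilon>2 \<cdot>\<^sub>m A" if "A \<in> carrier_mat p p" for A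
    by (rule pencil_in_structured_pencils_iff[OF new(2) that])

  have part2: "pencil (M + \<Delta>M) (K + \<Delta>K) \<in> structured_pencils n star \<epsilon>1 \<epsilon>2"
    if "pencil Mh Kh \<in> structured_pencils p star \<epsilon>1 \<epsilon>2"
  proof -
    have "star Mh = \<epsilon>1 \<cdot>\<^sub>m Mh" "star Kh = \<epsilon>2 \<cdot>\<^sub>m Kh"
      using that struct_hat[OF new(3)] by auto
    then have "star \<Delta>M = \<epsilon>1 \<cdot>\<^sub>m \<Delta>M" "star \<Delta>K = \<epsilon>2 \<cdot>\<^sub>m \<Delta>K"
      using star_congruence[OF star new(2) _ Uc] star_congruence[OF star new(3) _ Uc]
      by (auto simp: \<Delta>M \<Delta>K)
    then have "star (M + \<Delta>M) = \<epsilon>1 \<cdot>\<^sub>m (M + \<Delta>M)" "star (K + \<Delta>K) = \<epsilon>2 \<cdot>\<^sub>m (K + \<Delta>K)"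
      using MK DM DK
      by (simp_all add: star_add[OF star, of _ n n] sM sK add_smult_distrib_left_mat[of _ n n])
    then show ?thesis using MK DM DK by (subst pencil_in_structured_pencils_iff) auto
  qed

  define S where "S = (Mh + G) * \<Lambda>a"
  have Sc: "S \<in> carrier_mat p p" using new Gc by (auto simp: S_def)
  have GLc: "G * \<Lambda>c \<in> carrier_mat p p" using Gc Lc by auto
  have S_Kh: "S + Kh = G * \<Lambda>c"
  proof -
    have MhLa: "Mh * \<Lambda>a \<in> carrier_mat p p" and GLa: "G * \<Lambda>a \<in> carrier_mat p p"
      using new Gc by auto
    have "S + Kh = (Mh * \<Lambda>a + G * \<Lambda>a) + Kh"
      unfolding S_def using add_mult_distrib_mat[OF new(2) Gc new(1)] by simp
    also have "\<dots> = Mh * \<Lambda>a + (Kh + G * \<Lambda>a)"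
      using assoc_add_mat[OF MhLa GLa new(3)] comm_add_mat[OF GLa new(3)] by simp
    also have "\<dots> = (Mh * \<Lambda>a + Kh) + G * \<Lambda>a"
      using assoc_add_mat[OF MhLa new(3) GLa] by simp
    also have "\<dots> = (G * \<Lambda>c - G * \<Lambda>a) + G * \<Lambda>a"
      unfolding eq using Gc Lc new by (simp add: mult_minus_distrib_mat[of _ p p _ p])
    also have "\<dots> = G * \<Lambda>c" by (rule mat_add_diff_cancel(2)[OF GLa GLc])
    finally show ?thesis .
  qed
  \<comment> \<open>The deflating equation gives \<open>G \<Lambda>c = - Xc\<^sup>\<star> K Xc\<close>, a congruence of \<open>K\<close>.\<close>
  have sGLc: "star (G * \<Lambda>c) = \<epsilon>2 \<cdot>\<^sub>m (G * \<Lambda>c)"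
  proof -
    define N where "N = star Xc * K * Xc"
    have N: "N \<in> carrier_mat p p" using sXc MK Xc by (auto simp: N_def)
    have sN: "star N = \<epsilon>2 \<cdot>\<^sub>m N"
      using star_congruence[OF star MK(2) sK sXc] by (simp add: N_def star_star[OF star])
    have "0\<^sub>m p p = star Xc * (M * Xc * \<Lambda>c + K * Xc)"
      using sXc by (simp add: eqc)
    also have "\<dots> = star Xc * (M * Xc * \<Lambda>c) + star Xc * (K * Xc)"
      using sXc MXc KXc Lc by (intro mult_add_distrib_mat) auto
    also have "\<dots> = G * \<Lambda>c + N"
      unfolding G N_def using sXc MK Xc Lc
      by (simp add: assoc_mult_mat[of _ p n _ n _ p] assoc_mult_mat[of _ p n _ p _ p] assoc_mult_mat[of _ n n _ p _ p])
    finally have zero: "G * \<Lambda>c + N = 0\<^sub>m p p" by simp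
    have GN: "G * \<Lambda>c = 0\<^sub>m p p - N"
      unfolding zero[symmetric] comm_add_mat[OF GLc N] mat_add_diff_cancel(3)[OF N GLc] ..
    have "star (G * \<Lambda>c) = 0\<^sub>m p p - \<epsilon>2 \<cdot>\<^sub>m N"
      unfolding GN by (subst star_minus[OF star zero_carrier_mat N]) (simp add: star_zero[OF star] sN)
    also have "\<dots> = \<epsilon>2 \<cdot>\<^sub>m (G * \<Lambda>c)" unfolding GN using N by auto
    finally show ?thesis .
  qed
  \<comment> \<open>Applied with \<open>(A, B)\<close> equal to \<open>(S, Kh)\<close> and to \<open>(Kh, S)\<close>, one for each direction of the
    equivalence.\<close>
  have sym_transfer: "star B = \<epsilon>2 \<cdot>\<^sub>m B"
    if "A \<in> carrier_mat p p" "B \<in> carrier_mat p p" "A + B = G * \<Lambda>c" "star A = \<epsilon>2 \<cdot>\<^sub>m A" for A B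
  proof -
    have B: "B = G * \<Lambda>c - A" unfolding that(3)[symmetric] using mat_add_diff_cancel(3)[OF that(1,2)] by simp
    show ?thesis
      unfolding B star_minus[OF star GLc that(1)] sGLc that(4)
      by (rule smult_minus_mat[OF GLc that(1)])
  qed
  have "star Kh = \<epsilon>2 \<cdot>\<^sub>m Kh \<longleftrightarrow> star S = \<epsilon>2 \<cdot>\<^sub>m S"
    using sym_transfer[OF Sc new(3) S_Kh] sym_transfer[OF new(3) Sc] S_Kh comm_add_mat[OF Sc new(3)]
    by auto
  then have "pencil Mh Kh \<in> structured_pencils p star \<epsilon>1 \<epsilon>2 \<longleftrightarrow>
      pencil Mh S \<in> structured_pencils p star \<epsilon>1 \<epsilon>2"
    using struct_hat[OF new(3)] struct_hat[OF Sc] by auto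
  with part1 part2 show ?thesis unfolding S_def by blast
qed

end
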